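(* Let $L$ be an arbitrary lattice. There exists a partial ordering $\sqsubseteq$ on the set of weak factorization systems (transfer systems) on $L$ which refines $\preccurlyeq$ (that is, $\mathcal{R}\sqsubseteq\mathcal{R}'$ implies $\mathcal{R}\preccurlyeq\mathcal{R}'$) such that $\mathcal{R} \sqsubseteq \mathcal{R}'$ if and only if the pair $(\mathcal{R},\mathcal{R}')$ forms a model structure.
   Context: A lattice $L$ is regarded as a category with exactly one morphism $x \to y$ when $x \leqslant y$. A weak factorization system on $L$ is a pair $(\mathcal{L},\mathcal{R})$ of classes of morphisms such that: every morphism $f$ factors as $f = p i$ with $i \in \mathcal{L}$, $p \in \mathcal{R}$; every morphism in $\mathcal{L}$ has the left lifting property against every morphism in $\mathcal{R}$ (in a lattice: if $x \to y$ is in $\mathcal{L}$, $a \to b$ is in $\mathcal{R}$, $x \leqslant a$ and $y \leqslant b$, then $y \leqslant a$); and $\mathcal{L},\mathcal{R}$ are closed under retracts. It is determined by its right class, so it is denoted simply by $\mathcal{R}$; the left class corresponding to $\mathcal{R}'$ is $\mathcal{L}'$. Write $\mathcal{R} \leqslant \mathcal{R}'$ if $\mathcal{R} \subseteq \mathcal{R}'$. $\mathcal{R} \circ \mathcal{L}'$ is the class of morphisms $x \to y$ for which there is $z$ with $x \to z$ in $\mathcal{L}'$ and $z \to y$ in $\mathcal{R}$. $\mathcal{R}\preccurlyeq\mathcal{R}'$ means $\mathcal{R}\leqslant\mathcal{R}'$ and $\mathcal{R}\circ\mathcal{L}'$ is closed under composition (this is a partial order). The pair $(\mathcal{R},\mathcal{R}')$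 is a model structure if $\mathcal{R}\leqslant\mathcal{R}'$ and $\mathcal{W}=\mathcal{R}\circ\mathcal{L}'$ satisfies two-out-of-three: for composable $f,g$, if two of $f,g,f\circ g$ are in $\mathcal{W}$ then so is the third. *)

theory Defs
  imports Main
begin

text \<open>
  A lattice is viewed as a category with a unique morphism from \<open>x\<close> to \<open>y\<close> whenever \<open>x \<le> y\<close>;
  this morphism is represented by the pair \<open>(x, y)\<close>. All diagrams commute, so the equations in
  the usual categorical definitions hold automatically and only the existence of the
  morphisms involved has to be stated.
\<close>

definition lattice_mors :: "('a::lattice \<times> 'a) set" where
  "lattice_mors = {(x, y). x \<le> y}"

definition has_lifting :: "('a::lattice \<times> 'a) \<Rightarrow> ('a \<times> 'a) \<Rightarrow> bool" where
  "has_lifting i p \<longleftrightarrow> (fst i \<le> fst p \<longrightarrow> snd i \<le> snd p \<longrightarrow> snd i \<le> fst p)"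

text \<open>
  \<open>f\<close> is a retract of \<open>g\<close> if there are morphisms \<open>f \<rightarrow> g \<rightarrow> f\<close> in the arrow category; their
  composite is automatically the identity.
\<close>

definition retract_of_morphism :: "('a::lattice \<times> 'a) \<Rightarrow> ('a \<times> 'a) \<Rightarrow> bool" where
  "retract_of_morphism f g \<longleftrightarrow>
     fst f \<le> fst g \<and> snd f \<le> snd g \<and> fst g \<le> fst f \<and> snd g \<le> snd f"

definition retract_closed :: "('a::lattice \<times> 'a) set \<Rightarrow> bool" where
  "retract_closed M \<longleftrightarrow>
     (\<forall>g\<in>M. \<forall>f\<in>lattice_mors. retract_of_morphism f g \<longrightarrow> f \<in> M)"

text \<open>
  Classes are combined in the order of composition of functions: a morphism of
  \<open>mor_comp R L\<close> is a morphism in \<open>L\<close> followed by one in \<open>R\<close>.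
\<close>

definition mor_comp :: "('a::lattice \<times> 'a) set \<Rightarrow> ('a \<times> 'a) set \<Rightarrow> ('a \<times> 'a) set" where
  "mor_comp R L = {(x, y). \<exists>z. (x, z) \<in> L \<and> (z, y) \<in> R}"

definition comp_closed :: "('a::lattice \<times> 'a) set \<Rightarrow> bool" where
  "comp_closed W \<longleftrightarrow> (\<forall>x y z. (x, y) \<in> W \<longrightarrow> (y, z) \<in> W \<longrightarrow> (x, z) \<in> W)"

definition two_out_of_three :: "('a::lattice \<times> 'a) set \<Rightarrow> bool" where
  "two_out_of_three W \<longleftrightarrow>
     (\<forall>x y z. (x, y) \<in> lattice_mors \<longrightarrow> (y, z) \<in> lattice_mors \<longrightarrow>
        ((x, y) \<in> W \<and> (y, z) \<in> W \<longrightarrow> (x, z) \<in> W) \<and>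
        ((x, y) \<in> W \<and> (x, z) \<in> W \<longrightarrow> (y, z) \<in> W) \<and>
        ((y, z) \<in> W \<and> (x, z) \<in> W \<longrightarrow> (x, y) \<in> W))"

type_synonym 'a factorization_pair = "('a \<times> 'a) set \<times> ('a \<times> 'a) set"

abbreviation left_class :: "'a factorization_pair \<Rightarrow> ('a \<times> 'a) set" where
  "left_class \<equiv> fst"

abbreviation right_class :: "'a factorization_pair \<Rightarrow> ('a \<times> 'a) set" where
  "right_class \<equiv> snd"

definition weak_factorization_system :: "'a::lattice factorization_pair \<Rightarrow> bool" where
  "weak_factorization_system S \<longleftrightarrow>
     left_class S \<subseteq> lattice_mors \<and> right_class S \<subseteq> lattice_mors \<and>
     (\<forall>(x, y)\<in>lattice_mors. \<exists>z. (x, z) \<in> left_class S \<and> (z, y) \<in> right_class S) \<and>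
     (\<forall>i\<in>left_class S. \<forall>p\<in>right_class S. has_lifting i p) \<and>
     retract_closed (left_class S) \<and> retract_closed (right_class S)"

definition wfs_le :: "'a::lattice factorization_pair \<Rightarrow> 'a factorization_pair \<Rightarrow> bool" where
  "wfs_le S S' \<longleftrightarrow> right_class S \<subseteq> right_class S'"

definition wfs_comp_le :: "'a::lattice factorization_pair \<Rightarrow> 'a factorization_pair \<Rightarrow> bool" where
  "wfs_comp_le S S' \<longleftrightarrow>
     wfs_le S S' \<and> comp_closed (mor_comp (right_class S) (left_class S'))"

text \<open>
  In a model structure given by \<open>(S, S')\<close>, the acyclic fibrations are the right class of \<open>S\<close>
  and the acyclic cofibrations the left class of \<open>S'\<close>; the class of weak equivalences is
  \<open>mor_comp (right_class S) (left_class S')\<close>.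
\<close>

definition model_structure :: "'a::lattice factorization_pair \<Rightarrow> 'a factorization_pair \<Rightarrow> bool" where
  "model_structure S S' \<longleftrightarrow>
     wfs_le S S' \<and> two_out_of_three (mor_comp (right_class S) (left_class S'))"

end

theory Submission
  imports Defs
begin

text \<open>
  The order is the relation of forming a model structure; the point is its transitivity. For
  model structures \<open>(R, R')\<close> and \<open>(R', R'')\<close> the class \<open>R \<circ> L''\<close> is the intersection of
  \<open>R \<circ> L'\<close> and \<open>R' \<circ> L''\<close>, and two-out-of-three is stable under intersections. Indeed, if
  \<open>f\<close> lies in both classes, write \<open>f = p i\<close> with \<open>i \<in> L''\<close> and \<open>p \<in> R'\<close>. Since
  \<open>i \<in> L'' \<subseteq> L' \<subseteq> R \<circ> L'\<close>, two-out-of-three puts \<open>p\<close> into \<open>R \<circ> L'\<close>, and a morphism of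
  \<open>R'\<close> in \<open>R \<circ> L'\<close> lies in \<open>R\<close> because the \<open>L'\<close>-part lifts against it.
\<close>

lemma wfs_left_mor: "weak_factorization_system S \<Longrightarrow> (x, y) \<in> left_class S \<Longrightarrow> x \<le> y"
  by (auto simp: weak_factorization_system_def lattice_mors_def)

lemma wfs_right_mor: "weak_factorization_system S \<Longrightarrow> (x, y) \<in> right_class S \<Longrightarrow> x \<le> y"
  by (auto simp: weak_factorization_system_def lattice_mors_def)

lemma wfs_factor:
  assumes "weak_factorization_system S" "x \<le> y"
  obtains z where "(x, z) \<in> left_class S" "(z, y) \<in> right_class S"
  using assms by (fastforce simp: weak_factorization_system_def lattice_mors_def)

lemma wfs_lift:
  assumes "weak_factorization_system S" "(x, y) \<in> left_class S" "(a, b) \<in> right_class S"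
    "x \<le> a" "y \<le> b"
  shows "y \<le> a"
  using assms by (fastforce simp: weak_factorization_system_def has_lifting_def)

text \<open>Factor such a morphism as \<open>x\<close> to \<open>z\<close> to \<open>y\<close>:
  lifting against its own right part gives \<open>y \<le> z\<close>, so \<open>z = y\<close> and the
  left part is the whole morphism. Hence the right class determines the system.\<close>

lemma wfs_left_class_iff:
  assumes "weak_factorization_system S"
  shows "(x, y) \<in> left_class S \<longleftrightarrow>
    x \<le> y \<and> (\<forall>a b. (a, b) \<in> right_class S \<longrightarrow> x \<le> a \<longrightarrow> y \<le> b \<longrightarrow> y \<le> a)"
proof
  assume *: "x \<le> y \<and> (\<forall>a b. (a, b) \<in> right_class S \<longrightarrow> x \<le> a \<longrightarrow> y \<le> b \<longrightarrow> y \<le> a)"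
  then obtain z where z: "(x, z) \<in> left_class S" "(z, y) \<in> right_class S"
    using assms wfs_factor by blast
  have "z = y"
    using * z(2) wfs_left_mor[OF assms z(1)] wfs_right_mor[OF assms z(2)]
    by (blast intro: order.antisym)
  with z show "(x, y) \<in> left_class S" by simp
qed (use assms wfs_left_mor wfs_lift in blast)

lemma wfs_right_class_refl:
  assumes "weak_factorization_system S"
  shows "(x, x) \<in> right_class S"
proof -
  obtain z where z: "(x, z) \<in> left_class S" "(z, x) \<in> right_class S"
    using wfs_factor[OF assms order_refl] .
  then have "z = x"
    using wfs_left_mor[OF assms z(1)] wfs_right_mor[OF assms z(2)] by simp
  with z show ?thesis by simp
qed

text \<open>A larger right class imposes more lifting conditions on the left class.\<close>

lemma wfs_le_left_class:
  assumes "weak_factorization_system S" "weak_factorization_system S'" "wfs_le S S'"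
  shows "left_class S' \<subseteq> left_class S"
proof (rule subrelI)
  fix x y assume "(x, y) \<in> left_class S'"
  then show "(x, y) \<in> left_class S"
    using assms(3) unfolding wfs_le_def wfs_left_class_iff[OF assms(1)]
      wfs_left_class_iff[OF assms(2)] by blast
qed

lemma wfs_le_antisym:
  assumes "weak_factorization_system S" "weak_factorization_system S'"
    "wfs_le S S'" "wfs_le S' S"
  shows "S = S'"
  using assms wfs_le_left_class[of S S'] wfs_le_left_class[of S' S]
  by (auto simp: wfs_le_def prod_eq_iff)

lemma mor_comp_subset_lattice_mors:
  assumes "weak_factorization_system S" "weak_factorization_system S'"
  shows "mor_comp (right_class S) (left_class S') \<subseteq> lattice_mors"
  by (auto simp: mor_comp_def lattice_mors_def
      dest!: wfs_right_mor[OF assms(1)] wfs_left_mor[OF assms(2)] intro: order_trans)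

text \<open>By factorization every morphism is a weak equivalence here, so two-out-of-three reduces
  to transitivity of \<le>.\<close>

lemma model_structure_refl:
  assumes "weak_factorization_system S"
  shows "model_structure S S"
proof -
  have "mor_comp (right_class S) (left_class S) = lattice_mors"
    using mor_comp_subset_lattice_mors[OF assms assms] wfs_factor[OF assms]
    by (fastforce simp: mor_comp_def lattice_mors_def)
  then show ?thesis
    by (auto simp: model_structure_def wfs_le_def two_out_of_three_def lattice_mors_def
        intro: order_trans)
qed

lemma two_out_of_three_Int:
  "two_out_of_three W \<Longrightarrow> two_out_of_three W' \<Longrightarrow> two_out_of_three (W \<inter> W')"
  unfolding two_out_of_three_def by blast

text \<open>Composition closure is the first clause of two-out-of-three, once weak equivalences are
  known to be morphisms.\<close>

lemma model_structure_imp_wfs_comp_le: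
  assumes "weak_factorization_system S" "weak_factorization_system S'" "model_structure S S'"
  shows "wfs_comp_le S S'"
  using assms mor_comp_subset_lattice_mors[OF assms(1,2)]
  unfolding model_structure_def wfs_comp_le_def two_out_of_three_def comp_closed_def by blast

lemma acyclic_fibration_in_right_class:
  assumes "weak_factorization_system S'" "(x, y) \<in> right_class S'"
    "(x, y) \<in> mor_comp (right_class S) (left_class S')"
    "right_class S \<subseteq> right_class S'"
  shows "(x, y) \<in> right_class S"
proof -
  obtain z where z: "(x, z) \<in> left_class S'" "(z, y) \<in> right_class S"
    using assms(3) by (auto simp: mor_comp_def)
  \<comment> \<open>Lift \<open>(x, z)\<close> against \<open>(x, y)\<close> itself. Then
    \<open>z = x\<close>, and the remaining factor \<open>(z, y)\<close> is the given
    morphism.\<close>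
  have "z \<le> x"
    using assms z wfs_lift[OF assms(1) z(1) assms(2)] wfs_right_mor[OF assms(1)] by auto
  with z show ?thesis
    using wfs_left_mor[OF assms(1) z(1)] by (simp add: order.antisym)
qed

lemma model_structure_mor_comp_Int:
  assumes wfs: "weak_factorization_system S" "weak_factorization_system S'"
      "weak_factorization_system S''"
    and ms: "model_structure S S'" and le: "wfs_le S' S''"
  shows "mor_comp (right_class S) (left_class S'') =
    mor_comp (right_class S) (left_class S') \<inter> mor_comp (right_class S') (left_class S'')"
    (is "?W = ?W1 \<inter> ?W2")
proof
  have R: "right_class S \<subseteq> right_class S'"
    using ms by (simp add: model_structure_def wfs_le_def)
  have L: "left_class S'' \<subseteq> left_class S'"
    using wfs_le_left_class wfs le by blast
  show "?W \<subseteq> ?W1 \<inter> ?W2"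
    using R L by (fastforce simp: mor_comp_def)
  show "?W1 \<inter> ?W2 \<subseteq> ?W"
  proof (rule subrelI)
    fix x y assume xy: "(x, y) \<in> ?W1 \<inter> ?W2"
    then obtain z where z: "(x, z) \<in> left_class S''" "(z, y) \<in> right_class S'"
      by (auto simp: mor_comp_def)
    \<comment> \<open>The identity \<open>(z, z)\<close> serves as the factor in the right class of
      \<open>S\<close>.\<close>
    have "(x, z) \<in> ?W1"
      using z L wfs_right_class_refl[OF wfs(1)] by (auto simp: mor_comp_def)
    moreover have "(x, z) \<in> lattice_mors" "(z, y) \<in> lattice_mors"
      using wfs_left_mor[OF wfs(3) z(1)] wfs_right_mor[OF wfs(2) z(2)]
      by (simp_all add: lattice_mors_def)
    ultimately have "(z, y) \<in> ?W1"
      using ms xy unfolding model_structure_def two_out_of_three_def by blast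
    then have "(z, y) \<in> right_class S"
      using acyclic_fibration_in_right_class wfs(2) z(2) R by blast
    with z show "(x, y) \<in> ?W" by (auto simp: mor_comp_def)
  qed
qed

lemma model_structure_trans:
  assumes "weak_factorization_system S" "weak_factorization_system S'"
    "weak_factorization_system S''" "model_structure S S'" "model_structure S' S''"
  shows "model_structure S S''"
  using assms model_structure_mor_comp_Int[of S S' S'']
  by (auto simp: model_structure_def wfs_le_def intro: two_out_of_three_Int)

theorem corollary3p13:
  shows "\<exists>r :: ('a::lattice factorization_pair) rel.
           partial_order_on {S. weak_factorization_system S} r \<and>
           (\<forall>S S'. (S, S') \<in> r \<longrightarrow> wfs_comp_le S S') \<and>
           (\<forall>S S'. weak_factorization_system S \<longrightarrow> weak_factorization_system S' \<longrightarrow>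
              ((S, S') \<in> r \<longleftrightarrow> model_structure S S'))"
proof -
  let ?r = "{(S :: 'a factorization_pair, S'). weak_factorization_system S \<and>
    weak_factorization_system S' \<and> model_structure S S'}"
  have "refl_on {S. weak_factorization_system S} ?r"
    by (auto simp: refl_on_def intro: model_structure_refl)
  moreover have "trans ?r"
    by (auto simp only: trans_def mem_Collect_eq case_prod_conv intro: model_structure_trans)
  \<comment> \<open>Mutual inclusion makes the right classes equal, and these determine the left
    classes.\<close>
  moreover have "antisym ?r"
    by (rule antisymI) (use wfs_le_antisym in \<open>auto simp: model_structure_def\<close>)
  moreover have "?r \<subseteq> {S. weak_factorization_system S} \<times> {S. weak_factorization_system S}"
    by auto
  ultimately have "partial_order_on {S. weak_factorization_system S} ?r"
    by (simp add: partial_order_on_def preorder_on_def)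
  then show ?thesis
    by (intro exI[of _ ?r]) (auto intro: model_structure_imp_wfs_comp_le)
qed

end
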